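(* Let $n$ be an odd positive integer. The nontrivial subgroups of $V_{8n}$ that are total perfect codes in some connected Cayley sum graph of $V_{8n}$ are exactly the subgroups $\langle a^n\rangle$, $\langle a^nb^2\rangle$, $\langle a^jb\rangle$ and $\langle a^jb^3\rangle$, where $j$ ranges over the odd integers with $1\leqslant j<2n$. In other words, there exist exactly $2n+2$ subgroups of $V_{8n}$ that are nontrivial total perfect codes in some connected Cayley sum graph of $V_{8n}$.
   Context: For an odd positive integer $n$, $V_{8n}$ is the group of order $8n$ with presentation $V_{8n}=\langle a,b : a^{2n}=b^4=1,\ ba=a^{-1}b^{-1},\ b^{-1}a=a^{-1}b\rangle$. A subset $X$ of a group $G$ is normal if $g^{-1}Xg = X$ for all $g \in G$ (equivalently, $X$ is a union of conjugacy classes of $G$). For a normal subset $X$ of $G$, the Cayley sum graph $\mathrm{CS}(G,X)$ is the graph with vertex set $G$ in which two vertices $g$ and $h$ are adjacent if and only if $gh \in X$ and $g \neq h$. A Cayley sum graph of $G$ is a graph $\mathrm{CS}(G,X)$ for some normal subset $X$ of $G$. A total perfect code in a graph $\Gamma$ is a subset $C$ of the vertex set $V(\Gamma)$ such that every vertex in $V(\Gamma)$ has exactly one neighbor in $C$. A subgroup $H$ is nontrivial if $H\neq\{1\}$. *)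

theory Defs
  imports "HOL-Algebra.Generated_Groups" "HOL-Algebra.Coset" "Graph_Theory.Digraph_Component"
begin

section \<open>Groups given by generators and relations\<close>

text \<open>The letter \<open>(x, True)\<close> stands for the generator \<open>x\<close> and \<open>(x, False)\<close> for its formal
  inverse. A relation \<open>u = v\<close> between words is the pair \<open>(u, v)\<close>.\<close>

type_synonym 'x gword = "('x \<times> bool) list"

definition word_inv :: "'x gword \<Rightarrow> 'x gword" where
  "word_inv w = rev (map (\<lambda>(x, e). (x, \<not> e)) w)"

inductive pres_eq :: "('x gword \<times> 'x gword) set \<Rightarrow> 'x gword \<Rightarrow> 'x gword \<Rightarrow> bool"
  for R where
  refl: "pres_eq R u u"
| sym: "pres_eq R u v \<Longrightarrow> pres_eq R v u"
| trans: "pres_eq R u v \<Longrightarrow> pres_eq R v w \<Longrightarrow> pres_eq R u w"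
| cong: "pres_eq R u u' \<Longrightarrow> pres_eq R v v' \<Longrightarrow> pres_eq R (u @ v) (u' @ v')"
| cancel: "pres_eq R [(x, e), (x, \<not> e)] []"
| rel: "(u, v) \<in> R \<Longrightarrow> pres_eq R u v"

definition pres_class :: "('x gword \<times> 'x gword) set \<Rightarrow> 'x gword \<Rightarrow> 'x gword set" where
  "pres_class R w = {v. pres_eq R w v}"

definition presented_group :: "('x gword \<times> 'x gword) set \<Rightarrow> 'x gword set monoid" where
  "presented_group R =
    \<lparr>carrier = range (pres_class R),
     monoid.mult = (\<lambda>U V. \<Union>u\<in>U. \<Union>v\<in>V. pres_class R (u @ v)),
     one = pres_class R []\<rparr>"

lemma pres_class_eq_iff: "pres_class R u = pres_class R v \<longleftrightarrow> pres_eq R u v"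
  unfolding pres_class_def by (blast intro: pres_eq.refl pres_eq.sym pres_eq.trans)

lemma carrier_presented_group: "carrier (presented_group R) = range (pres_class R)"
  by (simp add: presented_group_def)

lemma one_presented_group: "\<one>\<^bsub>presented_group R\<^esub> = pres_class R []"
  by (simp add: presented_group_def)

lemma mult_presented_group:
  "pres_class R u \<otimes>\<^bsub>presented_group R\<^esub> pres_class R v = pres_class R (u @ v)"
proof -
  have "pres_class R (u' @ v') = pres_class R (u @ v)"
    if "u' \<in> pres_class R u" "v' \<in> pres_class R v" for u' v'
  proof -
    have "pres_eq R u u'" "pres_eq R v v'" using that by (simp_all add: pres_class_def)
    then show ?thesis unfolding pres_class_eq_iff by (intro pres_eq.sym[OF pres_eq.cong])
  qed
  moreover have "u \<in> pres_class R u" "v \<in> pres_class R v"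
    by (simp_all add: pres_class_def pres_eq.refl)
  ultimately have "(\<Union>u'\<in>pres_class R u. \<Union>v'\<in>pres_class R v. pres_class R (u' @ v'))
      = pres_class R (u @ v)"
    by blast
  then show ?thesis by (simp add: presented_group_def)
qed

lemma pres_eq_word_inv: "pres_eq R (word_inv w @ w) []"
proof (induction w)
  case Nil
  show ?case by (simp add: word_inv_def pres_eq.refl)
next
  case (Cons p w)
  obtain x e where p: "p = (x, e)" by force
  have "pres_eq R ([(x, \<not> e), (x, e)] @ w) ([] @ w)"
    using pres_eq.cong[OF pres_eq.cancel[of R x "\<not> e"] pres_eq.refl[of R w]] by simp
  then have "pres_eq R (word_inv w @ ([(x, \<not> e), (x, e)] @ w)) (word_inv w @ ([] @ w))"
    by (rule pres_eq.cong[OF pres_eq.refl])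
  then have "pres_eq R (word_inv (p # w) @ p # w) (word_inv w @ w)"
    by (simp add: word_inv_def p)
  then show ?case using Cons.IH by (rule pres_eq.trans)
qed

lemma group_presented_group: "group (presented_group R)"
proof (rule groupI)
  fix X assume "X \<in> carrier (presented_group R)"
  then obtain w where "X = pres_class R w" by (auto simp: carrier_presented_group)
  then have "pres_class R (word_inv w) \<otimes>\<^bsub>presented_group R\<^esub> X = \<one>\<^bsub>presented_group R\<^esub>"
    by (simp add: mult_presented_group one_presented_group pres_class_eq_iff pres_eq_word_inv)
  then show "\<exists>Y\<in>carrier (presented_group R). Y \<otimes>\<^bsub>presented_group R\<^esub> X = \<one>\<^bsub>presented_group R\<^esub>"
    by (auto simp: carrier_presented_group)
qed (auto simp: carrier_presented_group one_presented_group mult_presented_group)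

section \<open>The group \<open>V\<^sub>8\<^sub>n\<close>\<close>

datatype V8_gen = GA | GB

definition V8_relations :: "nat \<Rightarrow> (V8_gen gword \<times> V8_gen gword) set" where
  "V8_relations n =
    {(replicate (2 * n) (GA, True), []),
     (replicate 4 (GB, True), []),
     ([(GB, True), (GA, True)], [(GA, False), (GB, False)]),
     ([(GB, False), (GA, True)], [(GA, False), (GB, True)])}"

definition V8 :: "nat \<Rightarrow> V8_gen gword set monoid" where
  "V8 n = presented_group (V8_relations n)"

definition V8_a :: "nat \<Rightarrow> V8_gen gword set" where
  "V8_a n = pres_class (V8_relations n) [(GA, True)]"

definition V8_b :: "nat \<Rightarrow> V8_gen gword set" where
  "V8_b n = pres_class (V8_relations n) [(GB, True)]"

section \<open>Cayley sum graphs and total perfect codes\<close>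

definition normal_subset :: "('g, 'm) monoid_scheme \<Rightarrow> 'g set \<Rightarrow> bool" where
  "normal_subset G X \<longleftrightarrow>
    X \<subseteq> carrier G \<and> (\<forall>g\<in>carrier G. inv\<^bsub>G\<^esub> g <#\<^bsub>G\<^esub> (X #>\<^bsub>G\<^esub> g) = X)"

text \<open>An undirected graph is a digraph whose arc relation is symmetric.\<close>

definition CS :: "('g, 'm) monoid_scheme \<Rightarrow> 'g set \<Rightarrow> 'g pair_pre_digraph" where
  "CS G X =
    \<lparr>pverts = carrier G,
     parcs = {(g, h). g \<in> carrier G \<and> h \<in> carrier G \<and> g \<otimes>\<^bsub>G\<^esub> h \<in> X \<and> g \<noteq> h}\<rparr>"

definition cayley_sum_graph :: "('g, 'm) monoid_scheme \<Rightarrow> 'g pair_pre_digraph \<Rightarrow> bool" where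
  "cayley_sum_graph G \<Gamma> \<longleftrightarrow> (\<exists>X. normal_subset G X \<and> \<Gamma> = CS G X)"

definition total_perfect_code :: "'v pair_pre_digraph \<Rightarrow> 'v set \<Rightarrow> bool" where
  "total_perfect_code \<Gamma> C \<longleftrightarrow>
    C \<subseteq> pverts \<Gamma> \<and> (\<forall>v\<in>pverts \<Gamma>. \<exists>!c. c \<in> C \<and> (v, c) \<in> parcs \<Gamma>)"

lemma cayley_sum_graph_undirected:
  assumes "group G" and "cayley_sum_graph G \<Gamma>"
  shows "pair_bidirected_digraph \<Gamma>"
proof -
  interpret group G by fact
  obtain X where X: "normal_subset G X" and \<Gamma>: "\<Gamma> = CS G X"
    using assms(2) by (auto simp: cayley_sum_graph_def)
  have "h \<otimes>\<^bsub>G\<^esub> g \<in> X"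
    if g: "g \<in> carrier G" and h: "h \<in> carrier G" and gh: "g \<otimes>\<^bsub>G\<^esub> h \<in> X" for g h
  proof -
    have "inv\<^bsub>G\<^esub> g \<otimes>\<^bsub>G\<^esub> (g \<otimes>\<^bsub>G\<^esub> h \<otimes>\<^bsub>G\<^esub> g) \<in> inv\<^bsub>G\<^esub> g <#\<^bsub>G\<^esub> (X #>\<^bsub>G\<^esub> g)"
      using gh by (auto simp: l_coset_def r_coset_def)
    also have "\<dots> = X" using X g by (simp add: normal_subset_def)
    finally show ?thesis using g h by (simp add: m_assoc[symmetric])
  qed
  then show ?thesis
    unfolding \<Gamma> CS_def by unfold_locales (auto simp: symmetric_def sym_def)
qed

end

theory Submission
  imports Defs
begin

text \<open>Every element of \<open>V\<^sub>8\<^sub>n\<close> is \<open>a\<^sup>i b\<^sup>j\<close>, with \<open>i\<close> determined modulo \<open>2n\<close> and \<open>j\<close> modulo \<open>4\<close>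
  (\<open>V8_elt_eq_iff\<close>), so the parities of \<open>i\<close> and \<open>j\<close> are homomorphisms. The claim is that a
  nontrivial subgroup is a code exactly if it is \<open>{1, z}\<close> for an involution \<open>z = a\<^sup>i b\<^sup>j\<close> with \<open>i\<close>
  odd; there are \<open>2n + 2\<close> of these.

  One connection set serves all of them: the elements with \<open>i\<close> odd are the complement of a
  subgroup of index two, so their sum graph is complete bipartite, and the ends of any edge of a
  complete bipartite graph form a total perfect code. The elements \<open>1\<close> and \<open>z\<close> are such ends
  (\<open>involution_outside_index_two_subgroup_is_code\<close>).

  Conversely, let the subgroup \<open>H\<close> be a code in the connected graph of \<open>X\<close>. Connectedness forces
  an element \<open>x = a\<^sup>p b\<^sup>q\<close> with \<open>q\<close> odd into \<open>X\<close>, and since \<open>n\<close> is odd the conjugates of \<open>x\<close> fill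
  the coset \<open>x K\<close>, where \<open>K\<close> is the subgroup of elements with both exponents even
  (\<open>conjugates_of_odd_b\<close>). A code that is a subgroup contains no nontrivial \<open>z\<close> that
  translates one nontrivial element of \<open>X\<close> to another (\<open>subgroup_code_separates_translates\<close>), so \<open>H\<close> meets \<open>K\<close> trivially. As \<open>K\<close> is
  normal with a Klein four-group as quotient, \<open>H\<close> embeds into that group and its nontrivial elements
  are involutions. In the coset with \<open>i\<close> even and \<open>j\<close> odd every square is \<open>b\<^sup>2\<close>, so \<open>H\<close> misses that
  coset. Hence \<open>H\<close> has order two, and \<open>i\<close> is odd for its nontrivial element.\<close>

section \<open>Cayley sum graphs and subgroups\<close>

lemma arcs_CS: "(u, v) \<in> parcs (CS G X) \<longleftrightarrow>
    u \<in> carrier G \<and> v \<in> carrier G \<and> u \<otimes>\<^bsub>G\<^esub> v \<in> X \<and> u \<noteq> v"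
  by (simp add: CS_def)

lemma pverts_CS: "pverts (CS G X) = carrier G"
  by (simp add: CS_def)

context group
begin

lemma normal_subset_conj:
  assumes "normal_subset G X" "x \<in> X" "g \<in> carrier G"
  shows "inv g \<otimes> x \<otimes> g \<in> X"
proof -
  have "inv g \<otimes> (x \<otimes> g) \<in> inv g <# (X #> g)"
    using assms(2) by (auto simp: l_coset_def r_coset_def)
  also have "\<dots> = X"
    using assms by (simp add: normal_subset_def)
  finally show ?thesis
    using assms by (auto simp: m_assoc normal_subset_def)
qed

lemma normal_subsetI:
  assumes X: "X \<subseteq> carrier G"
    and conj: "\<And>x g. x \<in> X \<Longrightarrow> g \<in> carrier G \<Longrightarrow> inv g \<otimes> x \<otimes> g \<in> X"
  shows "normal_subset G X"
  unfolding normal_subset_def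
proof (intro conjI ballI X equalityI subsetI)
  fix g x assume g: "g \<in> carrier G"
  show "x \<in> X" if "x \<in> inv g <# (X #> g)"
    using that conj g X by (auto simp: l_coset_def r_coset_def m_assoc subset_iff)
  show "x \<in> inv g <# (X #> g)" if "x \<in> X"
  proof -
    have x: "x \<in> carrier G" using that X by blast
    have "inv (inv g) \<otimes> x \<otimes> inv g \<in> X"
      using that g by (intro conj) auto
    moreover have "x = inv g \<otimes> ((inv (inv g) \<otimes> x \<otimes> inv g) \<otimes> g)"
      using g x by (simp add: m_assoc inv_solve_left)
    ultimately show ?thesis
      unfolding l_coset_def r_coset_def by blast
  qed
qed

text \<open>If \<open>X\<close> lay in a proper subgroup, the equation \<open>uv \<in> X\<close> would put every neighbour of a
  subgroup element back into the subgroup, and the subgroup would be a union of components.\<close>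

lemma connected_CS_not_in_proper_subgroup:
  assumes S: "subgroup S G" and proper: "S \<noteq> carrier G"
    and conn: "Digraph_Component.connected (with_proj (CS G X))"
  shows "\<not> X \<subseteq> S"
proof
  assume XS: "X \<subseteq> S"
  let ?M = "mk_symmetric (with_proj (CS G X))"
  obtain g where g: "g \<in> carrier G" "g \<notin> S"
    using proper subgroup.subset[OF S] by blast
  have "(\<one>, g) \<in> rtrancl_on (carrier G) (parcs ?M)"
    using conn g by (auto simp: Digraph_Component.connected_def strongly_connected_def
      reachable_def pverts_CS)
  then have "g \<in> S"
  proof (induction rule: rtrancl_on_induct)
    case base
    show ?case using S by (rule subgroup.one_closed)
  next
    case (step u v)
    have u: "u \<in> S" by fact
    then have uG: "u \<in> carrier G" "inv u \<in> S"
      using S by (auto intro: subgroup.mem_carrier subgroup.m_inv_closed)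
    have v: "v \<in> carrier G" and "u \<otimes> v \<in> S \<or> v \<otimes> u \<in> S"
      using step(2) XS by (auto simp: parcs_mk_symmetric arcs_CS)
    then consider "inv u \<otimes> (u \<otimes> v) \<in> S" | "(v \<otimes> u) \<otimes> inv u \<in> S"
      using S uG by (auto intro: subgroup.m_closed)
    then show ?case
    proof cases
      case 1
      then show ?thesis using uG v by (simp add: m_assoc[symmetric])
    next
      case 2
      then show ?thesis using uG v by (simp add: m_assoc)
    qed
  qed
  with g show False by simp
qed

text \<open>For \<open>z \<noteq> \<one>\<close> some vertex would have two neighbours in the code: the vertex \<open>x\<close> has \<open>\<one>\<close> and \<open>z\<close>
  if \<open>x \<notin> H\<close>, and the vertex \<open>\<one>\<close> has \<open>x\<close> and \<open>xz\<close> if \<open>x \<in> H\<close>.\<close>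

lemma subgroup_code_separates_translates:
  assumes H: "subgroup H G" and code: "total_perfect_code (CS G X) H"
    and x: "x \<in> carrier G" "x \<in> X" "x \<noteq> \<one>"
    and z: "z \<in> H" and xz: "x \<otimes> z \<in> X" "x \<otimes> z \<noteq> \<one>"
  shows "z = \<one>"
proof -
  have zG: "z \<in> carrier G" and oneH: "\<one> \<in> H"
    using H z by (auto intro: subgroup.mem_carrier subgroup.one_closed)
  have unique: "c = d" if "v \<in> carrier G" "c \<in> H" "d \<in> H" "(v, c) \<in> parcs (CS G X)"
      "(v, d) \<in> parcs (CS G X)" for v c d
    using code that by (auto simp: total_perfect_code_def pverts_CS)
  show ?thesis
  proof (cases "x \<in> H")
    case False
    have "\<one> = z"
      using False x z xz zG oneH by (intro unique[of x]) (auto simp: arcs_CS)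
    then show ?thesis by simp
  next
    case True
    then have "x \<otimes> z \<in> H"
      using H z by (auto intro: subgroup.m_closed)
    then have "x = x \<otimes> z"
      using True x z xz zG by (intro unique[of \<one>]) (auto simp: arcs_CS)
    then show ?thesis
      using x zG by simp
  qed
qed

lemma generate_involution:
  assumes "z \<in> carrier G" "z \<otimes> z = \<one>"
  shows "generate G {z} = {\<one>, z}"
proof
  have "inv z = z"
    using assms by (simp add: inv_equality)
  then have "subgroup {\<one>, z} G"
    using assms by (intro subgroupI) auto
  then show "generate G {z} \<subseteq> {\<one>, z}"
    by (intro generate_subgroup_incl) auto
qed (auto intro: generate.intros)

text \<open>The complement of a subgroup \<open>N\<close> of index two is a connection set that makes the sum graph
  the complete bipartite graph with parts \<open>N\<close> and its complement. In a complete bipartite graph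
  the two ends of any edge form a total perfect code.\<close>

lemma involution_outside_index_two_subgroup_is_code:
  assumes N: "subgroup N G"
    and index_two: "\<And>g h. g \<in> carrier G - N \<Longrightarrow> h \<in> carrier G - N \<Longrightarrow> g \<otimes> h \<in> N"
    and z: "z \<in> carrier G" "z \<notin> N" "z \<otimes> z = \<one>"
  shows "\<exists>\<Gamma>. cayley_sum_graph G \<Gamma> \<and> Digraph_Component.connected (with_proj \<Gamma>) \<and>
    total_perfect_code \<Gamma> {\<one>, z}"
proof -
  let ?\<Gamma> = "CS G (carrier G - N)"
  have prod: "g \<otimes> h \<in> N \<longleftrightarrow> (g \<in> N \<longleftrightarrow> h \<in> N)" if "g \<in> carrier G" "h \<in> carrier G" for g h
  proof -
    have "h \<in> N" if "g \<in> N" "g \<otimes> h \<in> N"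
      using subgroup.m_closed[OF N subgroup.m_inv_closed[OF N that(1)] that(2)]
        \<open>g \<in> carrier G\<close> \<open>h \<in> carrier G\<close> by (simp add: m_assoc[symmetric])
    moreover have "g \<in> N" if "h \<in> N" "g \<otimes> h \<in> N"
      using subgroup.m_closed[OF N that(2) subgroup.m_inv_closed[OF N that(1)]]
        \<open>g \<in> carrier G\<close> \<open>h \<in> carrier G\<close> by (simp add: m_assoc)
    ultimately show ?thesis
      using index_two that subgroup.m_closed[OF N] by blast
  qed
  have oneN: "\<one> \<in> N" using N by (rule subgroup.one_closed)
  have invN: "inv g \<in> N \<longleftrightarrow> g \<in> N" if "g \<in> carrier G" for g
    using prod[of g "inv g"] that oneN by simp
  have "normal_subset G (carrier G - N)"
    by (rule normal_subsetI) (auto simp: prod invN)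
  then have sum_graph: "cayley_sum_graph G ?\<Gamma>"
    by (auto simp: cayley_sum_graph_def)
  have adj: "(u, v) \<in> parcs ?\<Gamma> \<longleftrightarrow> u \<in> carrier G \<and> v \<in> carrier G \<and> (u \<in> N) \<noteq> (v \<in> N)" for u v
    by (auto simp: arcs_CS prod)
  have "strongly_connected (mk_symmetric (with_proj ?\<Gamma>))"
  proof (rule strongly_connectedI)
    show "verts (mk_symmetric (with_proj ?\<Gamma>)) \<noteq> {}"
      by (auto simp: pverts_CS)
    fix u v
    assume "u \<in> verts (mk_symmetric (with_proj ?\<Gamma>))" "v \<in> verts (mk_symmetric (with_proj ?\<Gamma>))"
    then have uv: "u \<in> carrier G" "v \<in> carrier G" by (auto simp: pverts_CS)
    let ?R = "rtrancl_on (carrier G) (parcs (mk_symmetric (with_proj ?\<Gamma>)))"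
    have arc: "(s, t) \<in> ?R" if "s \<in> carrier G" "t \<in> carrier G" "(s \<in> N) \<noteq> (t \<in> N)" for s t
    proof (rule rtrancl_on_into_rtrancl_on)
      show "(s, s) \<in> ?R" using that by auto
      show "(s, t) \<in> parcs (mk_symmetric (with_proj ?\<Gamma>))"
        unfolding parcs_mk_symmetric
        by (rule UN_I[of "(s, t)"]) (use that in \<open>simp_all add: adj\<close>)
    qed (use that in auto)
    have "(u, v) \<in> ?R"
    proof (cases "(u \<in> N) = (v \<in> N)")
      case True
      have "\<exists>w \<in> carrier G. (u \<in> N) \<noteq> (w \<in> N)"
        using oneN z by (cases "u \<in> N") auto
      then obtain w where "w \<in> carrier G" "(u \<in> N) \<noteq> (w \<in> N)" ..
      then show ?thesis
        using True uv arc by (intro rtrancl_on_trans[of u w _ _ v] arc) auto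
    qed (use uv arc in auto)
    then show "u \<rightarrow>\<^sup>*\<^bsub>mk_symmetric (with_proj ?\<Gamma>)\<^esub> v"
      by (simp add: reachable_def pverts_CS)
  qed
  then have conn: "Digraph_Component.connected (with_proj ?\<Gamma>)"
    by (simp add: Digraph_Component.connected_def)
  have "total_perfect_code ?\<Gamma> {\<one>, z}"
    unfolding total_perfect_code_def
  proof (intro conjI ballI)
    show "{\<one>, z} \<subseteq> pverts ?\<Gamma>" using z by (simp add: pverts_CS)
    fix v assume "v \<in> pverts ?\<Gamma>"
    then show "\<exists>!c. c \<in> {\<one>, z} \<and> (v, c) \<in> parcs ?\<Gamma>"
      using oneN z by (cases "v \<in> N") (auto simp: pverts_CS adj)
  qed
  with sum_graph conn show ?thesis by blast
qed

end

section \<open>Products of powers of the generators\<close>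

text \<open>The three relations that do not bound the order of \<open>a\<close> suffice to bring every product into the form
  \<open>a\<^sup>i b\<^sup>j\<close>: they make \<open>b\<^sup>2\<close> central and conjugation by \<open>b\<close> sends \<open>a\<close> to \<open>a\<^sup>-\<^sup>1 b\<^sup>-\<^sup>2\<close>.\<close>

locale V8_pair = group G for G (structure) +
  fixes a b
  assumes a_closed [simp]: "a \<in> carrier G" and b_closed [simp]: "b \<in> carrier G"
    and b_pow_4: "b [^] (4::int) = \<one>"
    and b_a: "b \<otimes> a = inv a \<otimes> inv b"
    and inv_b_a: "inv b \<otimes> a = inv a \<otimes> b"
begin

definition elt :: "int \<Rightarrow> int \<Rightarrow> 'a" where
  "elt i j = a [^] i \<otimes> b [^] j"

lemma elt_closed [simp]: "elt i j \<in> carrier G"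
  by (simp add: elt_def)

lemma b_inv_a: "b \<otimes> inv a = a \<otimes> inv b"
proof -
  have "b \<otimes> inv a \<otimes> b = b \<otimes> (inv b \<otimes> a)"
    by (simp add: inv_b_a m_assoc)
  also have "\<dots> = a" by (simp add: m_assoc[symmetric])
  finally show ?thesis
    using inv_solve_right[of "b \<otimes> inv a" a b] by simp
qed

lemma int_pow_commutes:
  assumes "x \<otimes> y = y \<otimes> x" "x \<in> carrier G" "y \<in> carrier G"
  shows "x [^] (k::int) \<otimes> y = y \<otimes> x [^] k"
proof (cases k)
  case (nonneg m)
  then show ?thesis using assms by (simp add: int_pow_int group_commutes_pow)
next
  case (neg m)
  have "x \<otimes> (y \<otimes> inv x) = y"
    using assms by (simp add: m_assoc[symmetric]) (simp add: m_assoc)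
  then have "inv x \<otimes> y = y \<otimes> inv x"
    using assms inv_solve_left[of "y \<otimes> inv x" x y] by simp
  then have "inv x [^] Suc m \<otimes> y = y \<otimes> inv x [^] Suc m"
    using assms by (intro group_commutes_pow) auto
  then show ?thesis
    unfolding neg int_pow_neg_int[OF assms(2)] using assms(2) by (simp only: nat_pow_inv)
qed

lemma b_square_commutes: "b [^] (2::int) \<otimes> a = a \<otimes> b [^] (2::int)"
proof -
  have sq: "b [^] (2::int) = b \<otimes> b"
    using int_pow_mult[of b 1 1] by simp
  \<comment> \<open>Two applications of the commutation relations give \<open>b\<^sup>2 a = a b\<^sup>-\<^sup>2\<close>; the order of \<open>b\<close> removes
    the sign.\<close>
  have "b \<otimes> b \<otimes> a = b \<otimes> inv a \<otimes> inv b"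
    by (simp add: m_assoc b_a)
  also have "\<dots> = a \<otimes> inv (b [^] (2::int))"
    by (simp add: b_inv_a m_assoc sq inv_mult_group)
  also have "inv (b [^] (2::int)) = b [^] (2::int)"
    using int_pow_mult[of b 2 2] b_pow_4 by (intro inv_equality) simp_all
  finally show ?thesis by (simp add: sq)
qed

lemma b_even_pow_commutes:
  assumes "even j"
  shows "b [^] (j::int) \<otimes> a [^] (k::int) = a [^] k \<otimes> b [^] j"
proof -
  obtain m where j: "j = 2 * m" using assms by blast
  have "a [^] k \<otimes> b [^] (2::int) = b [^] (2::int) \<otimes> a [^] k"
    using b_square_commutes by (rule int_pow_commutes[OF HOL.sym]) simp_all
  then have "(b [^] (2::int)) [^] m \<otimes> a [^] k = a [^] k \<otimes> (b [^] (2::int)) [^] m"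
    by (rule int_pow_commutes[OF HOL.sym]) simp_all
  then show ?thesis
    by (simp add: j int_pow_pow)
qed

lemma b_a_int_pow: "b \<otimes> a [^] (k::int) = a [^] (- k) \<otimes> b [^] (1 - 2 * k)"
proof -
  have "(\<lambda>x. b \<otimes> x \<otimes> inv b) \<in> hom G G"
    by (auto simp: hom_def m_assoc inv_solve_left)
  from hom_int_pow[OF this a_closed is_group is_group, of k]
  have "b \<otimes> a [^] k \<otimes> inv b = (b \<otimes> a \<otimes> inv b) [^] k" .
  also have "b \<otimes> a \<otimes> inv b = a [^] (-1::int) \<otimes> b [^] (-2::int)"
    using int_pow_mult[of b "-1" "-1"] by (simp add: b_a m_assoc int_pow_neg)
  also have "\<dots> [^] k = a [^] (- k) \<otimes> b [^] (- 2 * k)"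
    by (subst int_pow_mult_distrib) (simp_all add: b_even_pow_commutes int_pow_pow)
  finally have "b \<otimes> a [^] k = a [^] (- k) \<otimes> b [^] (- 2 * k) \<otimes> b"
    using inv_solve_right[of "a [^] (- k) \<otimes> b [^] (- 2 * k)" "b \<otimes> a [^] k" b] by simp
  also have "\<dots> = a [^] (- k) \<otimes> b [^] (- 2 * k + 1)"
    by (simp only: int_pow_mult[OF b_closed]) (simp add: m_assoc)
  finally show ?thesis by simp
qed

lemma elt_mult_even:
  assumes "even j"
  shows "elt i j \<otimes> elt k l = elt (i + k) (j + l)"
proof -
  have "elt i j \<otimes> elt k l = a [^] i \<otimes> (b [^] j \<otimes> a [^] k) \<otimes> b [^] l"
    by (simp add: elt_def m_assoc)
  also have "\<dots> = (a [^] i \<otimes> a [^] k) \<otimes> (b [^] j \<otimes> b [^] l)"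
    using assms by (simp add: b_even_pow_commutes m_assoc)
  finally show ?thesis by (simp add: elt_def int_pow_mult)
qed

lemma elt_mult_odd:
  assumes "odd j"
  shows "elt i j \<otimes> elt k l = elt (i - k) (j + l - 2 * k)"
proof -
  have b: "b \<otimes> elt k l = elt (- k) (1 + l - 2 * k)"
  proof -
    have "b \<otimes> elt k l = a [^] (- k) \<otimes> (b [^] (1 - 2 * k) \<otimes> b [^] l)"
      by (simp add: elt_def m_assoc[symmetric] b_a_int_pow)
    then show ?thesis by (simp add: elt_def int_pow_mult[symmetric] algebra_simps)
  qed
  \<comment> \<open>Split off one \<open>b\<close>, which leaves the even case.\<close>
  have "elt i j = elt i (j - 1) \<otimes> b"
    using int_pow_mult[of b "j - 1" 1] by (simp add: elt_def m_assoc)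
  then have "elt i j \<otimes> elt k l = elt i (j - 1) \<otimes> elt (- k) (1 + l - 2 * k)"
    by (simp add: m_assoc b)
  then show ?thesis
    using assms by (simp add: elt_mult_even add_diff_eq)
qed

lemma elt_0_0: "elt 0 0 = \<one>"
  by (simp add: elt_def)

lemma inv_elt: "inv (elt i j) = (if even j then elt (- i) (- j) else elt i (2 * i - j))"
proof (rule inv_equality)
  show "(if even j then elt (- i) (- j) else elt i (2 * i - j)) \<otimes> elt i j = \<one>"
    by (simp add: elt_mult_even elt_mult_odd elt_0_0)
qed auto

end

section \<open>The normal form in \<open>V\<^sub>8\<^sub>n\<close>\<close>

text \<open>Left multiplication by a letter, written on the exponents \<open>(i, j)\<close> of \<open>a\<^sup>i b\<^sup>j\<close>.\<close>

fun letter_action :: "V8_gen \<times> bool \<Rightarrow> int \<times> int \<Rightarrow> int \<times> int" where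
  "letter_action (GA, e) (k, l) = (if e then k + 1 else k - 1, l)"
| "letter_action (GB, e) (k, l) = (- k, if e then l + 1 - 2 * k else l - 1 - 2 * k)"

definition same_exponents :: "nat \<Rightarrow> int \<times> int \<Rightarrow> int \<times> int \<Rightarrow> bool" where
  "same_exponents n p q \<longleftrightarrow> 2 * int n dvd fst p - fst q \<and> 4 dvd snd p - snd q"

lemma same_exponents_refl: "same_exponents n p p"
  by (simp add: same_exponents_def)

lemma same_exponents_sym: "same_exponents n p q \<Longrightarrow> same_exponents n q p"
  by (simp add: same_exponents_def dvd_diff_commute)

lemma same_exponents_trans:
  "same_exponents n p q \<Longrightarrow> same_exponents n q r \<Longrightarrow> same_exponents n p r"
  unfolding same_exponents_def
  using dvd_add[of "2 * int n" "fst p - fst q" "fst q - fst r"]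
    dvd_add[of 4 "snd p - snd q" "snd q - snd r"] by simp

lemma letter_action_cong:
  assumes "same_exponents n p q"
  shows "same_exponents n (letter_action x p) (letter_action x q)"
proof -
  obtain k l k' l' where p: "p = (k, l)" and q: "q = (k', l')"
    by (cases p, cases q) auto
  have k: "2 * int n dvd k - k'" and l: "4 dvd l - l'"
    using assms by (simp_all add: p q same_exponents_def)
  have k2: "2 * int n dvd k' - k" using k by (simp add: dvd_diff_commute)
  have "2 dvd k - k'" using k by (rule dvd_mult_left)
  then have l2: "4 dvd (l + c - 2 * k) - (l' + c - 2 * k')" for c
    using l by presburger
  show ?thesis
    using k k2 l l2[of 1] l2[of "-1"]
    by (cases "(x, p)" rule: letter_action.cases) (auto simp: p q same_exponents_def)
qed

lemma foldr_letter_action_cong: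
  "same_exponents n p q \<Longrightarrow>
    same_exponents n (foldr letter_action w p) (foldr letter_action w q)"
  by (induction w) (simp_all add: letter_action_cong)

lemma foldr_letter_action_a: "foldr letter_action (replicate m (GA, True)) (k, l) = (k + int m, l)"
  by (induction m) auto

lemma foldr_letter_action_b: "foldr letter_action (replicate m (GB, True)) (0, l) = (0, l + int m)"
  by (induction m) auto

lemma replicate_4: "replicate 4 x = [x, x, x, x]"
  by (simp add: numeral_eq_Suc)

text \<open>This action is the reason why the relations collapse no further than to \<open>8n\<close> elements: it
  respects all of them modulo \<open>2n\<close> and \<open>4\<close>, so the exponents of a group element are determined up to multiples of
  \<open>2n\<close> and \<open>4\<close>.\<close>

lemma pres_eq_same_exponents:
  assumes "pres_eq (V8_relations n) u v"
  shows "same_exponents n (foldr letter_action u p) (foldr letter_action v p)"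
  using assms
proof (induction arbitrary: p)
  case (refl u)
  show ?case by (rule same_exponents_refl)
next
  case (sym u v)
  then show ?case by (blast intro: same_exponents_sym)
next
  case (trans u v w)
  then show ?case by (blast intro: same_exponents_trans)
next
  case (cong u u' v v')
  show ?case
    unfolding foldr_append comp_def
    using cong.IH by (blast intro: same_exponents_trans foldr_letter_action_cong)
next
  case (cancel x e)
  show ?case
    by (cases p; cases x; cases e) (simp_all add: same_exponents_def)
next
  case (rel u v)
  obtain k l where "p = (k, l)" by force
  with rel show ?case
    by (auto simp: V8_relations_def same_exponents_def foldr_letter_action_a replicate_4
        simp del: foldr_replicate)
qed

lemma pow_pres_class: "pres_class R w [^]\<^bsub>presented_group R\<^esub> (m::nat) =
    pres_class R (concat (replicate m w))"
proof (induction m)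
  case 0
  show ?case by (simp add: one_presented_group)
next
  case (Suc m)
  have "concat (replicate m w) @ w = concat (replicate (Suc m) w)"
    by (induction m) auto
  then show ?case
    using Suc by (simp add: mult_presented_group)
qed

lemma inv_pres_class:
  "inv\<^bsub>presented_group R\<^esub> pres_class R w = pres_class R (word_inv w)"
proof -
  interpret group "presented_group R" by (rule group_presented_group)
  show ?thesis
    by (rule inv_equality)
      (auto simp: mult_presented_group one_presented_group carrier_presented_group
        pres_class_eq_iff pres_eq_word_inv)
qed

locale V8_group =
  fixes n :: nat
  assumes odd_n: "odd n"

sublocale V8_group \<subseteq> V8_pair "V8 n" "V8_a n" "V8_b n"
proof -
  interpret group "V8 n"
    unfolding V8_def by (rule group_presented_group)
  have inv_a: "inv\<^bsub>V8 n\<^esub> V8_a n = pres_class (V8_relations n) [(GA, False)]"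
    and inv_b: "inv\<^bsub>V8 n\<^esub> V8_b n = pres_class (V8_relations n) [(GB, False)]"
    by (simp_all add: V8_def V8_a_def V8_b_def inv_pres_class word_inv_def)
  have rel: "pres_class (V8_relations n) u = pres_class (V8_relations n) v"
    if "(u, v) \<in> V8_relations n" for u v
    using that by (simp add: pres_class_eq_iff pres_eq.rel)
  have b4: "V8_b n [^]\<^bsub>V8 n\<^esub> (4::nat) = \<one>\<^bsub>V8 n\<^esub>"
    unfolding V8_b_def V8_def
    unfolding pow_pres_class one_presented_group
    by (rule rel) (simp add: V8_relations_def replicate_4)
  show "V8_pair (V8 n) (V8_a n) (V8_b n)"
  proof
    show "V8_a n \<in> carrier (V8 n)" "V8_b n \<in> carrier (V8 n)"
      by (auto simp: V8_def V8_a_def V8_b_def carrier_presented_group)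
    show "V8_b n [^]\<^bsub>V8 n\<^esub> (4::int) = \<one>\<^bsub>V8 n\<^esub>"
      using b4 int_pow_int[of "V8 n" "V8_b n" 4] by simp
    show "V8_b n \<otimes>\<^bsub>V8 n\<^esub> V8_a n = inv\<^bsub>V8 n\<^esub> V8_a n \<otimes>\<^bsub>V8 n\<^esub> inv\<^bsub>V8 n\<^esub> V8_b n"
      unfolding inv_a inv_b unfolding V8_def V8_a_def V8_b_def mult_presented_group
      by (rule rel) (simp add: V8_relations_def)
    show "inv\<^bsub>V8 n\<^esub> V8_b n \<otimes>\<^bsub>V8 n\<^esub> V8_a n = inv\<^bsub>V8 n\<^esub> V8_a n \<otimes>\<^bsub>V8 n\<^esub> V8_b n"
      unfolding inv_a inv_b unfolding V8_def V8_a_def V8_b_def mult_presented_group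
      by (rule rel) (simp add: V8_relations_def)
  qed
qed

context V8_group
begin

lemma a_pow_2n: "V8_a n [^]\<^bsub>V8 n\<^esub> (2 * int n) = \<one>\<^bsub>V8 n\<^esub>"
proof -
  have "V8_a n [^]\<^bsub>V8 n\<^esub> (2 * n) = \<one>\<^bsub>V8 n\<^esub>"
    unfolding V8_a_def V8_def pow_pres_class one_presented_group pres_class_eq_iff
    by (rule pres_eq.rel) (simp add: V8_relations_def)
  then show ?thesis
    using int_pow_int[of "V8 n" "V8_a n" "2 * n"] by simp
qed

lemma elt_cong:
  assumes "2 * int n dvd i - k" "4 dvd j - l"
  shows "elt i j = elt k l"
proof -
  obtain s t where "i = k + 2 * int n * s" "j = l + 4 * t"
    using assms by (metis add.commute diff_add_cancel dvdE)
  moreover have "V8_a n [^]\<^bsub>V8 n\<^esub> (2 * int n * s) = \<one>\<^bsub>V8 n\<^esub>" "V8_b n [^]\<^bsub>V8 n\<^esub> (4 * t) = \<one>\<^bsub>V8 n\<^esub>"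
    using a_pow_2n b_pow_4 by (simp_all add: int_pow_pow[symmetric])
  ultimately show ?thesis
    by (simp add: elt_def int_pow_mult)
qed

lemma pres_class_letter:
  "pres_class (V8_relations n) [(GA, True)] = elt 1 0"
  "pres_class (V8_relations n) [(GA, False)] = elt (- 1) 0"
  "pres_class (V8_relations n) [(GB, True)] = elt 0 1"
  "pres_class (V8_relations n) [(GB, False)] = elt 0 (- 1)"
proof -
  show a: "pres_class (V8_relations n) [(GA, True)] = elt 1 0"
    and b: "pres_class (V8_relations n) [(GB, True)] = elt 0 1"
    by (simp_all add: elt_def V8_a_def[symmetric] V8_b_def[symmetric])
  have "inv\<^bsub>V8 n\<^esub> elt 1 0 = pres_class (V8_relations n) [(GA, False)]"
    "inv\<^bsub>V8 n\<^esub> elt 0 1 = pres_class (V8_relations n) [(GB, False)]"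
    unfolding a[symmetric] b[symmetric] unfolding V8_def by (simp_all add: inv_pres_class word_inv_def)
  then show "pres_class (V8_relations n) [(GA, False)] = elt (- 1) 0"
    and "pres_class (V8_relations n) [(GB, False)] = elt 0 (- 1)"
    by (simp_all add: inv_elt)
qed

lemma letter_mult_elt:
  "pres_class (V8_relations n) [x] \<otimes>\<^bsub>V8 n\<^esub> elt k l =
    elt (fst (letter_action x (k, l))) (snd (letter_action x (k, l)))"
proof -
  obtain g e where "x = (g, e)" by force
  then show ?thesis
    by (cases g; cases e) (simp_all add: pres_class_letter elt_mult_even elt_mult_odd add.commute)
qed

lemma pres_class_eq_elt:
  "pres_class (V8_relations n) w =
    elt (fst (foldr letter_action w (0, 0))) (snd (foldr letter_action w (0, 0)))"
proof (induction w)
  case Nil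
  show ?case by (simp add: elt_0_0) (simp add: V8_def one_presented_group)
next
  case (Cons x w)
  have "pres_class (V8_relations n) (x # w) =
      pres_class (V8_relations n) [x] \<otimes>\<^bsub>V8 n\<^esub> pres_class (V8_relations n) w"
    by (simp add: V8_def mult_presented_group)
  then show ?case
    by (simp only: Cons letter_mult_elt) simp
qed

lemma carrier_V8: "carrier (V8 n) = {elt i j | i j. True}"
proof
  show "carrier (V8 n) \<subseteq> {elt i j | i j. True}"
  proof
    fix x assume "x \<in> carrier (V8 n)"
    then obtain w where "x = pres_class (V8_relations n) w"
      by (auto simp: V8_def carrier_presented_group)
    then show "x \<in> {elt i j | i j. True}"
      using pres_class_eq_elt by blast
  qed
qed auto

lemma V8_elt_eq_iff: "elt i j = elt k l \<longleftrightarrow> 2 * int n dvd i - k \<and> 4 dvd j - l"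
proof
  have elt_word: "\<exists>w. elt i j = pres_class (V8_relations n) w \<and>
      same_exponents n (foldr letter_action w (0, 0)) (i, j)" for i j
  proof -
    \<comment> \<open>Reduced exponents are natural numbers, so a word without inverse letters suffices.\<close>
    let ?i = "i mod (2 * int n)" and ?j = "j mod 4"
    let ?w = "replicate (nat ?i) (GA, True) @ replicate (nat ?j) (GB, True)"
    have w: "foldr letter_action ?w (0, 0) = (?i, ?j)"
      using odd_n by (simp add: foldr_letter_action_a foldr_letter_action_b odd_pos del: foldr_replicate)
    then have "same_exponents n (foldr letter_action ?w (0, 0)) (i, j)"
      by (simp add: same_exponents_def mod_eq_dvd_iff[symmetric])
    moreover from this have "pres_class (V8_relations n) ?w = elt i j"
      unfolding pres_class_eq_elt same_exponents_def by (intro elt_cong) auto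
    ultimately show ?thesis by metis
  qed
  assume "elt i j = elt k l"
  then have "same_exponents n (i, j) (k, l)"
    using elt_word[of i j] elt_word[of k l]
    by (metis pres_class_eq_iff pres_eq_same_exponents same_exponents_sym same_exponents_trans)
  then show "2 * int n dvd i - k \<and> 4 dvd j - l"
    by (simp add: same_exponents_def)
qed (simp add: elt_cong)

end

section \<open>Codes in terms of the normal form\<close>

locale V8_normal_form = V8_pair +
  fixes n :: nat
  assumes odd_n: "odd n"
    and carrier_eq: "carrier G = {elt i j | i j. True}"
    and elt_eq_iff: "elt i j = elt k l \<longleftrightarrow> 2 * int n dvd i - k \<and> 4 dvd j - l"
begin

lemma elt_eq_one_iff: "elt i j = \<one> \<longleftrightarrow> 2 * int n dvd i \<and> 4 dvd j"
  using elt_eq_iff[of i j 0 0] by (simp add: elt_0_0)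

lemma elt_eq_parity:
  assumes "elt i j = elt k l"
  shows "even i = even k" "even j = even l"
proof -
  have "2 * int n dvd i - k" and l: "4 dvd j - l"
    using assms by (simp_all add: elt_eq_iff)
  then have "2 dvd i - k" by (intro dvd_mult_left[of 2 "int n"])
  moreover have "2 dvd j - l" using l by presburger
  ultimately show "even i = even k" "even j = even l"
    by simp_all
qed

definition even_a :: "'a set" where
  "even_a = {elt i j | i j. even i}"

definition even_b :: "'a set" where
  "even_b = {elt i j | i j. even j}"

lemma elt_in_even_a [simp]: "elt i j \<in> even_a \<longleftrightarrow> even i"
  unfolding even_a_def by (auto dest: elt_eq_parity)

lemma elt_in_even_b [simp]: "elt i j \<in> even_b \<longleftrightarrow> even j"
  unfolding even_b_def by (auto dest: elt_eq_parity)

lemma subgroup_even_a: "subgroup even_a G"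
proof (rule subgroupI)
  show "even_a \<subseteq> carrier G" by (auto simp: even_a_def)
  show "even_a \<noteq> {}" using elt_in_even_a[of 0 0] by blast
  fix x assume "x \<in> even_a"
  then obtain i j where x: "x = elt i j" "even i" by (auto simp: even_a_def)
  then show "inv x \<in> even_a" by (simp add: inv_elt)
  fix y assume "y \<in> even_a"
  then obtain k l where y: "y = elt k l" "even k" by (auto simp: even_a_def)
  show "x \<otimes> y \<in> even_a"
    using x y by (cases "even j") (simp_all add: elt_mult_even elt_mult_odd)
qed

lemma subgroup_even_b: "subgroup even_b G"
proof (rule subgroupI)
  show "even_b \<subseteq> carrier G" by (auto simp: even_b_def)
  show "even_b \<noteq> {}" using elt_in_even_b[of 0 0] by blast
  fix x assume "x \<in> even_b"
  then obtain i j where x: "x = elt i j" "even j" by (auto simp: even_b_def)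
  then show "inv x \<in> even_b" by (simp add: inv_elt)
  fix y assume "y \<in> even_b"
  then obtain k l where y: "y = elt k l" "even l" by (auto simp: even_b_def)
  show "x \<otimes> y \<in> even_b"
    using x y by (simp add: elt_mult_even)
qed

text \<open>For odd \<open>j\<close>, conjugation by \<open>a\<^sup>m\<close> multiplies \<open>a\<^sup>i b\<^sup>j\<close> by \<open>(a\<^sup>2 b\<^sup>2)\<^sup>m\<close> from the right. As
  \<open>n\<close> is odd, \<open>a\<^sup>2 b\<^sup>2\<close> has order \<open>2n\<close> and generates all \<open>a\<^sup>s b\<^sup>t\<close> with \<open>s\<close> and \<open>t\<close> even, so these
  conjugates fill a whole coset of the group of such elements.\<close>

lemma conjugates_of_odd_b:
  assumes X: "normal_subset G X" and mem: "elt i j \<in> X" and j: "odd j"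
    and s: "even s" and t: "even t"
  shows "elt i j \<otimes> elt s t \<in> X"
proof -
  obtain s' where s': "s = 2 * s'" using s by blast
  \<comment> \<open>Solve \<open>2m \<equiv> s\<close> modulo \<open>2n\<close> and \<open>2m \<equiv> -t\<close> modulo \<open>4\<close>: adding \<open>n\<close> to a half of \<open>s\<close>
    changes its parity.\<close>
  define m where "m = (if 4 dvd s + t then s' else s' + int n)"
  have m1: "2 * int n dvd s - 2 * m"
    by (simp add: m_def s')
  have m2: "4 dvd t + 2 * m"
    using s' t odd_n unfolding m_def by (cases "4 dvd s + t") (simp_all, presburger+)
  have "inv (elt m 0) \<otimes> elt i j \<otimes> elt m 0 \<in> X"
    using X mem by (rule normal_subset_conj) simp
  also have "inv (elt m 0) \<otimes> elt i j \<otimes> elt m 0 = elt (i - 2 * m) (j - 2 * m)"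
    using j by (simp add: inv_elt elt_mult_even elt_mult_odd)
  also have "\<dots> = elt (i - s) (j + t - 2 * s)"
    unfolding elt_eq_iff
  proof
    show "2 * int n dvd i - 2 * m - (i - s)" using m1 by simp
    show "4 dvd j - 2 * m - (j + t - 2 * s)" using m2 s by presburger
  qed
  finally show ?thesis
    using j by (simp add: elt_mult_odd)
qed

lemma involution_iff:
  assumes "odd i"
  shows "elt i j \<otimes> elt i j = \<one> \<longleftrightarrow> odd j \<or> int n dvd i"
proof (cases "even j")
  case True
  then have "4 dvd j + j" by presburger
  moreover have "2 * int n dvd i + i \<longleftrightarrow> int n dvd i"
    by (simp flip: mult_2)
  ultimately show ?thesis
    using True by (simp add: elt_mult_even elt_eq_one_iff)
next
  case False
  then have "4 dvd j + j - 2 * i" using assms by presburger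
  then show ?thesis
    using False by (simp add: elt_mult_odd elt_eq_one_iff)
qed

lemma code_if_involution:
  assumes "odd i" "odd j \<or> int n dvd i"
  shows "subgroup {\<one>, elt i j} G" "{\<one>, elt i j} \<noteq> {\<one>}"
    "\<exists>\<Gamma>. cayley_sum_graph G \<Gamma> \<and> Digraph_Component.connected (with_proj \<Gamma>) \<and>
      total_perfect_code \<Gamma> {\<one>, elt i j}"
proof -
  have sq: "elt i j \<otimes> elt i j = \<one>"
    using assms by (simp add: involution_iff)
  show "subgroup {\<one>, elt i j} G"
    using generate_is_subgroup[of "{elt i j}"] generate_involution[OF _ sq] by simp
  have "elt i j \<notin> even_a" using assms by simp
  then show "{\<one>, elt i j} \<noteq> {\<one>}"
    using subgroup.one_closed[OF subgroup_even_a] by (metis insertCI singletonD)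
  show "\<exists>\<Gamma>. cayley_sum_graph G \<Gamma> \<and> Digraph_Component.connected (with_proj \<Gamma>) \<and>
      total_perfect_code \<Gamma> {\<one>, elt i j}"
  proof (rule involution_outside_index_two_subgroup_is_code[OF subgroup_even_a])
    fix g h assume "g \<in> carrier G - even_a" "h \<in> carrier G - even_a"
    then obtain i j k l where "g = elt i j" "h = elt k l" "odd i" "odd k"
      by (auto simp: carrier_eq)
    then show "g \<otimes> h \<in> even_a"
      by (cases "even j") (simp_all add: elt_mult_even elt_mult_odd)
  qed (use assms sq in auto)
qed

text \<open>The identity is the only element of \<open>H\<close> with two even exponents, because \<open>X\<close> contains a whole
  coset of such elements. An element with \<open>i\<close> even and \<open>j\<close> odd is not in \<open>H\<close> either, since its square
  is \<open>b\<^sup>2\<close>. So \<open>i\<close> is odd for all other elements of \<open>H\<close>; the product of any two of these has an even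
  first exponent and is therefore trivial, which leaves room for only one of them.\<close>

lemma involution_if_code:
  assumes H: "subgroup H G" and nontrivial: "H \<noteq> {\<one>}" and X: "normal_subset G X"
    and conn: "Digraph_Component.connected (with_proj (CS G X))"
    and code: "total_perfect_code (CS G X) H"
  obtains i j where "H = {\<one>, elt i j}" "odd i" "odd j \<or> int n dvd i"
proof -
  have XG: "X \<subseteq> carrier G" using X by (simp add: normal_subset_def)
  have "elt 0 1 \<in> carrier G" "elt 0 1 \<notin> even_b" by simp_all
  then have "even_b \<noteq> carrier G" by blast
  then have "\<not> X \<subseteq> even_b"
    by (rule connected_CS_not_in_proper_subgroup[OF subgroup_even_b _ conn])
  then obtain y where y: "y \<in> X" "y \<notin> even_b" by blast
  moreover from this obtain p q where "y = elt p q"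
    using XG by (auto simp: carrier_eq)
  ultimately have x: "elt p q \<in> X" and q: "odd q" by simp_all
  have ne_one: "elt k l \<noteq> \<one>" if "odd l" for k l
    using that by (auto simp: elt_eq_one_iff)
  have even_even: "elt s t = \<one>" if "elt s t \<in> H" "even s" "even t" for s t
  proof (rule subgroup_code_separates_translates[OF H code _ x _ that(1)])
    show "elt p q \<otimes> elt s t \<in> X"
      using X x q that by (intro conjugates_of_odd_b) auto
    show "elt p q \<otimes> elt s t \<noteq> \<one>"
      using q that by (simp add: elt_mult_odd ne_one)
  qed (use q in \<open>auto simp: ne_one\<close>)
  have mult: "g \<otimes> h \<in> H" if "g \<in> H" "h \<in> H" for g h
    using H that by (rule subgroup.m_closed)
  have even_trivial: "elt i j = \<one>" if mem: "elt i j \<in> H" and i: "even i" for i j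
  proof (cases "even j")
    case True
    then show ?thesis using even_even that by blast
  next
    case False
    have "elt 0 (2 * j - 2 * i) \<in> H"
      using mult[OF mem mem] False by (simp add: elt_mult_odd)
    then have "4 dvd 2 * j - 2 * i"
      using even_even by (fastforce simp: elt_eq_one_iff)
    with i False have False by presburger
    then show ?thesis ..
  qed
  have product_trivial: "elt i j \<otimes> elt k l = \<one>"
    if "elt i j \<in> H" "elt k l \<in> H" "odd i" "odd k" for i j k l
    using mult[OF that(1,2)] that even_trivial
    by (cases "even j") (simp_all add: elt_mult_even elt_mult_odd)
  have "\<one> \<in> H" using H by (rule subgroup.one_closed)
  then obtain h where h: "h \<in> H" "h \<noteq> \<one>" using nontrivial by blast
  then obtain i j where ij: "h = elt i j"
    using subgroup.subset[OF H] by (auto simp: carrier_eq)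
  with h even_trivial have i: "odd i" by blast
  have sq: "h \<otimes> h = \<one>"
    unfolding ij using product_trivial h i ij by blast
  have "g = h" if g: "g \<in> H" "g \<noteq> \<one>" for g
  proof -
    obtain k l where kl: "g = elt k l"
      using g subgroup.subset[OF H] by (auto simp: carrier_eq)
    with g even_trivial have "odd k" by blast
    then have "g \<otimes> h = \<one>"
      using product_trivial g h i unfolding ij kl by blast
    then have "g = inv h"
      using inv_equality[of g h] by (simp add: ij kl)
    also have "inv h = h"
      using inv_equality[OF sq] by (simp add: ij)
    finally show ?thesis .
  qed
  then have "H = {\<one>, elt i j}"
    using h \<open>\<one> \<in> H\<close> unfolding ij by blast
  moreover have "odd j \<or> int n dvd i"
    using sq i unfolding ij by (simp add: involution_iff)
  ultimately show ?thesis using i that by blast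
qed

text \<open>By \<open>involution_iff\<close>, these are the involutions outside \<open>even_a\<close>.\<close>

definition odd_involutions :: "'a set" where
  "odd_involutions = {elt i j | i j. odd i \<and> (odd j \<or> int n dvd i)}"

lemma codes_eq:
  "{H. subgroup H G \<and> H \<noteq> {\<one>} \<and> (\<exists>\<Gamma>. cayley_sum_graph G \<Gamma> \<and>
      Digraph_Component.connected (with_proj \<Gamma>) \<and> total_perfect_code \<Gamma> H)}
    = (\<lambda>z. {\<one>, z}) ` odd_involutions"
proof (intro equalityI subsetI)
  fix H assume "H \<in> {H. subgroup H G \<and> H \<noteq> {\<one>} \<and> (\<exists>\<Gamma>. cayley_sum_graph G \<Gamma> \<and>
      Digraph_Component.connected (with_proj \<Gamma>) \<and> total_perfect_code \<Gamma> H)}"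
  then obtain X where "subgroup H G" "H \<noteq> {\<one>}" "normal_subset G X"
      "Digraph_Component.connected (with_proj (CS G X))" "total_perfect_code (CS G X) H"
    by (auto simp: cayley_sum_graph_def)
  then obtain i j where "H = {\<one>, elt i j}" "odd i" "odd j \<or> int n dvd i"
    by (rule involution_if_code)
  then show "H \<in> (\<lambda>z. {\<one>, z}) ` odd_involutions"
    unfolding odd_involutions_def by blast
next
  fix H assume "H \<in> (\<lambda>z. {\<one>, z}) ` odd_involutions"
  then obtain i j where "H = {\<one>, elt i j}" "odd i" "odd j \<or> int n dvd i"
    unfolding odd_involutions_def by blast
  then show "H \<in> {H. subgroup H G \<and> H \<noteq> {\<one>} \<and> (\<exists>\<Gamma>. cayley_sum_graph G \<Gamma> \<and>
      Digraph_Component.connected (with_proj \<Gamma>) \<and> total_perfect_code \<Gamma> H)}"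
    using code_if_involution[of i j] by simp
qed

lemma odd_involutions_eq:
  "odd_involutions = (\<lambda>(i, j). elt i j) ` ({(int n, 0), (int n, 2)} \<union>
    int ` {j. odd j \<and> 1 \<le> j \<and> j < 2 * n} \<times> {1, 3})"
    (is "_ = ?f ` ?I")
proof (intro equalityI subsetI)
  fix z assume "z \<in> odd_involutions"
  then obtain i j where z: "z = elt i j" and i: "odd i" and inv: "odd j \<or> int n dvd i"
    by (auto simp: odd_involutions_def)
  show "z \<in> ?f ` ?I"
  proof (cases "odd j")
    case True
    define m where "m = nat (i mod (2 * int n))"
    let ?j = "j mod 4"
    have "n > 0" using odd_n by (rule odd_pos)
    then have m: "int m = i mod (2 * int n)" and "int m < 2 * int n"
      by (simp_all add: m_def)
    moreover from m have "odd m"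
      using i by (metis dvd_mod_iff dvd_triv_left even_of_nat)
    ultimately have "int m \<in> int ` {j. odd j \<and> 1 \<le> j \<and> j < 2 * n}"
      using odd_pos[of m] by (intro imageI) auto
    moreover have "?j \<in> {1, 3}" using True by simp presburger
    moreover have "z = ?f (int m, ?j)"
      by (simp add: z elt_eq_iff m minus_mod_eq_mult_div)
    ultimately show ?thesis by blast
  next
    case False
    then obtain k where k: "i = int n * k" using inv by auto
    with i have "odd k" by simp
    then obtain k' where "k = 2 * k' + 1" by (rule oddE)
    then have "2 * int n dvd i - int n" by (simp add: k algebra_simps)
    moreover have "4 dvd j - 0 \<or> 4 dvd j - 2" using False by presburger
    ultimately have "z = ?f (int n, 0) \<or> z = ?f (int n, 2)"
      by (auto simp: z elt_eq_iff)
    then show ?thesis by blast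
  qed
next
  fix z assume "z \<in> ?f ` ?I"
  then consider j where "z = elt (int n) j"
    | m j where "z = elt (int m) j" "odd m" "odd j"
    by auto
  then show "z \<in> odd_involutions"
  proof cases
    case 1
    then show ?thesis unfolding odd_involutions_def using odd_n by force
  next
    case 2
    then show ?thesis unfolding odd_involutions_def by force
  qed
qed

lemma card_odd_involutions: "card odd_involutions = 2 * n + 2"
proof -
  let ?J = "{j. odd j \<and> 1 \<le> j \<and> j < 2 * n}"
  let ?A = "{(int n, 0), (int n, 2)} :: (int \<times> int) set"
  let ?B = "int ` ?J \<times> {1, 3} :: (int \<times> int) set"
  have inj: "inj_on (\<lambda>(i, j). elt i j) ({0..<2 * int n} \<times> {0..<4})"
    by (auto simp: inj_on_def elt_eq_iff simp flip: mod_eq_dvd_iff)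
  have n_pos: "n > 0" using odd_n by (simp add: odd_pos)
  have "?J = (\<lambda>k. 2 * k + 1) ` {..<n}"
    by (auto elim!: oddE)
  then have J: "finite ?J" "card ?J = n"
    by (simp_all add: card_image inj_on_def)
  have "inj_on (\<lambda>(i, j). elt i j) (?A \<union> ?B)"
    by (rule inj_on_subset[OF inj]) (use n_pos in auto)
  then have "card odd_involutions = card (?A \<union> ?B)"
    unfolding odd_involutions_eq by (rule card_image)
  also have "\<dots> = card ?A + card ?B"
    using J by (intro card_Un_disjoint) auto
  also have "card ?B = 2 * n"
    using J by (simp add: card_cartesian_product card_image)
  finally show ?thesis by simp
qed

end

section \<open>The codes in \<open>V\<^sub>8\<^sub>n\<close>\<close>

sublocale V8_group \<subseteq> V8_normal_form "V8 n" "V8_a n" "V8_b n" n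
  by unfold_locales (rule odd_n carrier_V8 V8_elt_eq_iff)+

theorem theorem14:
  fixes n :: nat
  assumes "odd n"
  shows "{H. subgroup H (V8 n) \<and> H \<noteq> {\<one>\<^bsub>V8 n\<^esub>} \<and>
             (\<exists>\<Gamma>. cayley_sum_graph (V8 n) \<Gamma> \<and> Digraph_Component.connected (with_proj \<Gamma>) \<and> total_perfect_code \<Gamma> H)}
         = {generate (V8 n) {V8_a n [^]\<^bsub>V8 n\<^esub> n},
            generate (V8 n) {V8_a n [^]\<^bsub>V8 n\<^esub> n \<otimes>\<^bsub>V8 n\<^esub> V8_b n [^]\<^bsub>V8 n\<^esub> (2::nat)}}
           \<union> {generate (V8 n) {V8_a n [^]\<^bsub>V8 n\<^esub> j \<otimes>\<^bsub>V8 n\<^esub> V8_b n} | j :: nat.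
                odd j \<and> 1 \<le> j \<and> j < 2 * n}
           \<union> {generate (V8 n) {V8_a n [^]\<^bsub>V8 n\<^esub> j \<otimes>\<^bsub>V8 n\<^esub> V8_b n [^]\<^bsub>V8 n\<^esub> (3::nat)} | j :: nat.
                odd j \<and> 1 \<le> j \<and> j < 2 * n}
       \<and> card {H. subgroup H (V8 n) \<and> H \<noteq> {\<one>\<^bsub>V8 n\<^esub>} \<and>
             (\<exists>\<Gamma>. cayley_sum_graph (V8 n) \<Gamma> \<and> Digraph_Component.connected (with_proj \<Gamma>) \<and> total_perfect_code \<Gamma> H)}
         = 2 * n + 2"
    (is "?codes = ?R \<and> card ?codes = _")
proof
  interpret V8_group n
    using assms by unfold_locales
  let ?J = "{j. odd j \<and> 1 \<le> j \<and> j < 2 * n}"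
  let ?pair = "\<lambda>z. {\<one>\<^bsub>V8 n\<^esub>, z}"
  have codes: "?codes = ?pair ` odd_involutions"
    by (rule codes_eq)
  have gen: "generate (V8 n) {elt i j} = ?pair (elt i j)" if "odd i" "odd j \<or> int n dvd i" for i j
    using that by (intro generate_involution) (simp_all add: involution_iff)
  have elts: "V8_a n [^]\<^bsub>V8 n\<^esub> i = elt (int i) 0"
    "V8_a n [^]\<^bsub>V8 n\<^esub> i \<otimes>\<^bsub>V8 n\<^esub> V8_b n = elt (int i) 1"
    "V8_a n [^]\<^bsub>V8 n\<^esub> i \<otimes>\<^bsub>V8 n\<^esub> V8_b n [^]\<^bsub>V8 n\<^esub> j = elt (int i) (int j)" for i j
    by (simp_all add: elt_def int_pow_int)
  have gens: "{generate (V8 n) {elt (int j) k} | j. odd j \<and> 1 \<le> j \<and> j < 2 * n} =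
      (\<lambda>j. ?pair (elt (int j) k)) ` ?J" if "odd k" for k
  proof -
    have "{generate (V8 n) {elt (int j) k} | j. odd j \<and> 1 \<le> j \<and> j < 2 * n} =
        (\<lambda>j. generate (V8 n) {elt (int j) k}) ` ?J"
      by (rule setcompr_eq_image)
    also have "\<dots> = (\<lambda>j. ?pair (elt (int j) k)) ` ?J"
      using that by (intro image_cong) (simp_all add: gen)
    finally show ?thesis .
  qed
  have "?R = {?pair (elt (int n) 0), ?pair (elt (int n) 2)} \<union>
      (\<lambda>j. ?pair (elt (int j) 1)) ` ?J \<union> (\<lambda>j. ?pair (elt (int j) 3)) ` ?J"
    unfolding elts(2,3) of_nat_numeral unfolding elts(1)
    using assms gens[of 1] gens[of 3] by (simp add: gen)
  also have "\<dots> = ?pair ` odd_involutions"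
  proof -
    have "int ` ?J \<times> {1, 3 :: int} = (\<lambda>j. (int j, 1)) ` ?J \<union> (\<lambda>j. (int j, 3)) ` ?J"
      by auto
    then show ?thesis
      unfolding odd_involutions_eq by (simp only: image_Un image_image image_insert image_empty
        prod.case Un_assoc)
  qed
  finally show "?codes = ?R"
    unfolding codes by (rule HOL.sym)
  have "inj_on ?pair odd_involutions"
    by (auto simp: inj_on_def doubleton_eq_iff)
  then show "card ?codes = 2 * n + 2"
    unfolding codes by (simp add: card_image card_odd_involutions)
qed

end
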